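(* (Green's function for periodic BVPs.) Let $a<b$ with $[a,b]\subseteq\mathcal I$. Assume that the homogeneous periodic boundary value problem $$Lx=0,\qquad x(a)=e_0(a,b)x(b),\qquad D^{\alpha}x(a)=e_0(a,b)D^{\alpha}x(b)$$ has only the trivial solution. For each fixed $s\in\mathcal I$, let $u(\cdot,s)$ be the solution of the boundary value problem $$Lu(\cdot,s)=0,\quad u(a,s)=e_0(a,b)\left[u(b,s)+x(b,s)\right],\quad D^{\alpha}u(a,s)=e_0(a,b)\left[D^{\alpha}u(b,s)+D^{\alpha}x(b,s)\right],$$ where $x(t,s)$ is the Cauchy function for $Lx=0$ (this solution exists and is unique). Define $$G(t,s):=\begin{cases}u(t,s)&: t\le s,\\ v(t,s)&: t\ge s,\end{cases}$$ where $v(t,s):=u(t,s)+x(t,s)$. If $h$ is continuous, then $$x(t):=\int_a^bG(t,s)h(s)\,d_\alpha s$$ is the unique solution of the nonhomogeneous periodic boundary value problem $$Lx=h(t),\ t\in[a,b],\qquad x(a)-e_0(a,b)x(b)=0,\qquad D^{\alpha}x(a)-e_0(a,b)D^{\alpha}x(b)=0.$$ Furthermore, for each fixed $s\in[a,b]$, $v(\cdot,s)$ is a solution of $Lx=0$, and $$u(a,s)=e_0(a,b)v(b,s),\qquad D^{\alpha}u(a,s)=e_0(a,b)D^{\alpha}v(b,s).$$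
   Context: $\mathcal I\subseteq\mathbb R$ is a nondegenerate interval. The functions $\kappa_0,\kappa_1:[0,1]\times\mathcal I\to[0,\infty)$ are continuous and satisfy, for all $t\in\mathcal I$: $\lim_{\alpha\to0^+}\kappa_1(\alpha,t)=1$, $\lim_{\alpha\to0^+}\kappa_0(\alpha,t)=0$, $\lim_{\alpha\to1^-}\kappa_1(\alpha,t)=0$, $\lim_{\alpha\to1^-}\kappa_0(\alpha,t)=1$, $\kappa_1(\alpha,t)\ne0$ for $\alpha\in[0,1)$, and $\kappa_0(\alpha,t)\neq0$ for $\alpha\in(0,1]$. Fix $\alpha\in(0,1]$ and write $\kappa_j(t)=\kappa_j(\alpha,t)$. The conformable (proportional) derivative is $D^{\alpha}f(t)=\kappa_1(t)f(t)+\kappa_0(t)f'(t)$; for functions of $(t,s)$ it acts on the first variable, and e.g. $D^{\alpha}u(b,s)$ means the derivative of $u(\cdot,s)$ evaluated at $b$. Write $d_\alpha s=ds/\kappa_0(s)$ and $e_0(t,s)=\exp\left(-\int_s^t\frac{\kappa_1(\tau)}{\kappa_0(\tau)}\,d\tau\right)$ for $t,s\in\mathcal I$. Let $p,q$ be continuous on $\mathcal I$ with $p(t)>0$ for all $t\in\mathcal I$, and set $Lx=D^{\alpha}[pD^{\alpha}x]+qx$. A solution of $Lx=h$ is a continuous function $x$ such that $D^{\alpha}x$ and $D^{\alpha}[pD^{\alpha}x]$ exist and are continuous and $Lx=h$ holds at every point of the interval considered. The Cauchy function $x(t,s)$ for $Lx=0$ is defined by: for each fixed $s$, $x(\cdot,s)$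 is the solution of the initial value problem $Lx(\cdot,s)=0$, $x(s,s)=0$, $D^{\alpha}x(s,s)=1/p(s)$. *)

theory Defs
  imports "HOL-Analysis.Analysis"
begin

text \<open>The kernels are curried: \<open>\<kappa>0 \<alpha> t\<close> stands for $\kappa_0(\alpha,t)$.\<close>

definition conformable_kernels :: "real set \<Rightarrow> (real \<Rightarrow> real \<Rightarrow> real) \<Rightarrow> (real \<Rightarrow> real \<Rightarrow> real) \<Rightarrow> bool" where
  "conformable_kernels I \<kappa>0 \<kappa>1 \<longleftrightarrow>
     continuous_on ({0..1} \<times> I) (\<lambda>(\<alpha>, t). \<kappa>0 \<alpha> t) \<and>
     continuous_on ({0..1} \<times> I) (\<lambda>(\<alpha>, t). \<kappa>1 \<alpha> t) \<and>
     (\<forall>\<alpha>\<in>{0..1}. \<forall>t\<in>I. \<kappa>0 \<alpha> t \<ge> 0 \<and> \<kappa>1 \<alpha> t \<ge> 0) \<and>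
     (\<forall>t\<in>I.
        ((\<lambda>\<alpha>. \<kappa>1 \<alpha> t) \<longlongrightarrow> 1) (at_right 0) \<and>
        ((\<lambda>\<alpha>. \<kappa>0 \<alpha> t) \<longlongrightarrow> 0) (at_right 0) \<and>
        ((\<lambda>\<alpha>. \<kappa>1 \<alpha> t) \<longlongrightarrow> 0) (at_left 1) \<and>
        ((\<lambda>\<alpha>. \<kappa>0 \<alpha> t) \<longlongrightarrow> 1) (at_left 1) \<and>
        (\<forall>\<alpha>\<in>{0..<1}. \<kappa>1 \<alpha> t \<noteq> 0) \<and>
        (\<forall>\<alpha>\<in>{0<..1}. \<kappa>0 \<alpha> t \<noteq> 0))"

text \<open>In everything below, \<open>J\<close> is the interval on which the equation is considered. Derivatives
  are taken within \<open>J\<close>, i.e. they are one-sided at those endpoints of \<open>J\<close> that belong to \<open>J\<close>.\<close>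

definition conf_deriv ::
  "(real \<Rightarrow> real \<Rightarrow> real) \<Rightarrow> (real \<Rightarrow> real \<Rightarrow> real) \<Rightarrow> real \<Rightarrow> real set \<Rightarrow> (real \<Rightarrow> real) \<Rightarrow> real \<Rightarrow> real" where
  "conf_deriv \<kappa>0 \<kappa>1 \<alpha> J f t =
     \<kappa>1 \<alpha> t * f t + \<kappa>0 \<alpha> t * vector_derivative f (at t within J)"

text \<open>The integral is oriented: \<open>LBINT \<tau>=s..t\<close> changes sign when \<open>t < s\<close>.\<close>

definition conf_exp0 ::
  "(real \<Rightarrow> real \<Rightarrow> real) \<Rightarrow> (real \<Rightarrow> real \<Rightarrow> real) \<Rightarrow> real \<Rightarrow> real \<Rightarrow> real \<Rightarrow> real" where
  "conf_exp0 \<kappa>0 \<kappa>1 \<alpha> t s = exp (- (LBINT \<tau>=ereal s..ereal t. \<kappa>1 \<alpha> \<tau> / \<kappa>0 \<alpha> \<tau>))"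

definition conf_L ::
  "(real \<Rightarrow> real \<Rightarrow> real) \<Rightarrow> (real \<Rightarrow> real \<Rightarrow> real) \<Rightarrow> real \<Rightarrow> (real \<Rightarrow> real) \<Rightarrow> (real \<Rightarrow> real) \<Rightarrow>
   real set \<Rightarrow> (real \<Rightarrow> real) \<Rightarrow> real \<Rightarrow> real" where
  "conf_L \<kappa>0 \<kappa>1 \<alpha> p q J x t =
     conf_deriv \<kappa>0 \<kappa>1 \<alpha> J (\<lambda>\<tau>. p \<tau> * conf_deriv \<kappa>0 \<kappa>1 \<alpha> J x \<tau>) t + q t * x t"

text \<open>A conformable derivative counts as existing where the ordinary derivative in its defining
  formula exists.\<close>

definition conf_solution ::
  "(real \<Rightarrow> real \<Rightarrow> real) \<Rightarrow> (real \<Rightarrow> real \<Rightarrow> real) \<Rightarrow> real \<Rightarrow> (real \<Rightarrow> real) \<Rightarrow> (real \<Rightarrow> real) \<Rightarrow>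
   real set \<Rightarrow> (real \<Rightarrow> real) \<Rightarrow> (real \<Rightarrow> real) \<Rightarrow> bool" where
  "conf_solution \<kappa>0 \<kappa>1 \<alpha> p q J h x \<longleftrightarrow>
     (let Dx = conf_deriv \<kappa>0 \<kappa>1 \<alpha> J x; pDx = (\<lambda>t. p t * Dx t) in
        continuous_on J x \<and>
        (\<forall>t\<in>J. x differentiable (at t within J)) \<and> continuous_on J Dx \<and>
        (\<forall>t\<in>J. pDx differentiable (at t within J)) \<and>
        continuous_on J (conf_deriv \<kappa>0 \<kappa>1 \<alpha> J pDx) \<and>
        (\<forall>t\<in>J. conf_L \<kappa>0 \<kappa>1 \<alpha> p q J x t = h t))"

definition cauchy_function ::
  "(real \<Rightarrow> real \<Rightarrow> real) \<Rightarrow> (real \<Rightarrow> real \<Rightarrow> real) \<Rightarrow> real \<Rightarrow> (real \<Rightarrow> real) \<Rightarrow> (real \<Rightarrow> real) \<Rightarrow>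
   real set \<Rightarrow> (real \<Rightarrow> real \<Rightarrow> real) \<Rightarrow> bool" where
  "cauchy_function \<kappa>0 \<kappa>1 \<alpha> p q I X \<longleftrightarrow>
     (\<forall>s\<in>I. conf_solution \<kappa>0 \<kappa>1 \<alpha> p q I (\<lambda>_. 0) (\<lambda>t. X t s) \<and>
            X s s = 0 \<and> conf_deriv \<kappa>0 \<kappa>1 \<alpha> I (\<lambda>t. X t s) s = 1 / p s)"

definition periodic_bvp ::
  "(real \<Rightarrow> real \<Rightarrow> real) \<Rightarrow> (real \<Rightarrow> real \<Rightarrow> real) \<Rightarrow> real \<Rightarrow> (real \<Rightarrow> real) \<Rightarrow> (real \<Rightarrow> real) \<Rightarrow>
   real \<Rightarrow> real \<Rightarrow> (real \<Rightarrow> real) \<Rightarrow> (real \<Rightarrow> real) \<Rightarrow> bool" where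
  "periodic_bvp \<kappa>0 \<kappa>1 \<alpha> p q a b h x \<longleftrightarrow>
     (let D = conf_deriv \<kappa>0 \<kappa>1 \<alpha> {a..b}; e0 = conf_exp0 \<kappa>0 \<kappa>1 \<alpha> in
        conf_solution \<kappa>0 \<kappa>1 \<alpha> p q {a..b} h x \<and>
        x a - e0 a b * x b = 0 \<and> D x a - e0 a b * D x b = 0)"

text \<open>The problem defining $u(\cdot,s)$; the argument \<open>y\<close> is $x(\cdot,s)$, the section of the
  Cauchy function.\<close>

definition shifted_periodic_bvp ::
  "(real \<Rightarrow> real \<Rightarrow> real) \<Rightarrow> (real \<Rightarrow> real \<Rightarrow> real) \<Rightarrow> real \<Rightarrow> (real \<Rightarrow> real) \<Rightarrow> (real \<Rightarrow> real) \<Rightarrow>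
   real set \<Rightarrow> real \<Rightarrow> real \<Rightarrow> (real \<Rightarrow> real) \<Rightarrow> (real \<Rightarrow> real) \<Rightarrow> bool" where
  "shifted_periodic_bvp \<kappa>0 \<kappa>1 \<alpha> p q I a b y u \<longleftrightarrow>
     (let D = conf_deriv \<kappa>0 \<kappa>1 \<alpha> I; e0 = conf_exp0 \<kappa>0 \<kappa>1 \<alpha> in
        conf_solution \<kappa>0 \<kappa>1 \<alpha> p q I (\<lambda>_. 0) u \<and>
        u a = e0 a b * (u b + y b) \<and> D u a = e0 a b * (D u b + D y b))"

definition green_function ::
  "(real \<Rightarrow> real \<Rightarrow> real) \<Rightarrow> (real \<Rightarrow> real \<Rightarrow> real) \<Rightarrow> real \<Rightarrow> real \<Rightarrow> real" where
  "green_function u v t s = (if t \<le> s then u t s else v t s)"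

end

theory Submission
  imports Defs
begin

text \<open>With \<open>y = p D x\<close> the equation \<open>L x = h\<close> becomes the first-order system
  \<open>x' = (y / p - \<kappa>1 x) / \<kappa>0\<close>, \<open>y' = (h - q x - \<kappa>1 y) / \<kappa>0\<close>. By Abel's formula Wronskians are constant up
  to an exponential factor, and suitable sections of the Cauchy function have nonvanishing Wronskian, so
  Cramer's rule writes every homogeneous solution as a combination of these two: neither existence nor
  uniqueness for initial value problems has to be proved. In this basis \<open>x(t,s) = c1(s) x1(t) + c2(s) x2(t)\<close>
  and \<open>u(t,s) = d1(s) x1(t) + d2(s) x2(t)\<close> with continuous coefficients, where \<open>d1\<close>, \<open>d2\<close> solve a
  \<open>2 \<times> 2\<close> system that is regular because the homogeneous boundary value problem is trivial. The Green
  integral then is variation of parameters: \<open>\<integral> G h = \<Sum>\<^sub>i (\<integral>\<^sub>a\<^sup>b di h d\<^sub>\<alpha>s + \<integral>\<^sub>a\<^sup>t ci h d\<^sub>\<alpha>s) xi(t)\<close>.\<close>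

section \<open>Derivatives, antiderivatives and integrals on intervals\<close>

lemma vector_derivative_within_interval_eq:
  fixes f :: "real \<Rightarrow> real"
  assumes "is_interval J" "c \<in> J" "d \<in> J" "c \<noteq> d" "t \<in> J"
    and "(f has_real_derivative f') (at t within J)"
  shows "vector_derivative f (at t within J) = f'"
proof (rule vector_derivative_within)
  \<comment> \<open>A connected set with two points has no isolated point, so derivatives within
    \<open>J\<close> are unique, also at its endpoints.\<close>
  have "t islimpt J"
    by (rule connected_imp_perfect) (use assms in \<open>auto simp: is_interval_connected_1\<close>)
  then show "at t within J \<noteq> bot"
    by (simp add: trivial_limit_within)
  show "(f has_vector_derivative f') (at t within J)"
    using assms(6) by (simp add: has_real_derivative_iff_has_vector_derivative)
qed

text \<open>The integral from a fixed base point works, but the fundamental theorem is applied on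
  compact intervals, while \<open>J\<close> may be open or unbounded. Differentiability within
  \<open>J\<close> is local, so each \<open>t\<close> gets its own compact interval inside
  \<open>J\<close>.\<close>

lemma interval_antiderivative_exists:
  fixes f :: "real \<Rightarrow> real"
  assumes J: "is_interval J" and f: "continuous_on J f"
  shows "\<exists>F. \<forall>t\<in>J. (F has_real_derivative f t) (at t within J)"
proof (cases "J = {}")
  case False
  then obtain t0 where t0: "t0 \<in> J" by blast
  have "((\<lambda>u. LBINT y=ereal t0..ereal u. f y) has_real_derivative f t) (at t within J)"
    if t: "t \<in> J" for t
  proof -
    \<comment> \<open>\<open>c\<close> is the left end of a compact interval containing
      \<open>t\<close> and \<open>t0\<close>; no point of \<open>J\<close> above \<open>c'\<close>
      lies below \<open>c\<close>. If \<open>t\<close> is the least element of \<open>J\<close>,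
      then \<open>c = t\<close> and any \<open>c' < t\<close> serves.\<close>
    obtain c c' where c: "c \<in> J" "c' < t" "c \<le> t" "c \<le> t0" "\<And>s. s \<in> J \<Longrightarrow> c' < s \<Longrightarrow> c \<le> s"
    proof (cases "\<exists>c\<in>J. c < t")
      case True
      then obtain c where "c \<in> J" "c < t" by blast
      then show thesis
        by (intro that[of "min c t0" c]) (use t0 in \<open>auto simp: min_def\<close>)
    next
      case False
      then show thesis
        by (intro that[of t "t - 1"]) (use t t0 in \<open>auto simp: not_less\<close>)
    qed
    obtain d d' where d: "d \<in> J" "t < d'" "t \<le> d" "t0 \<le> d" "\<And>s. s \<in> J \<Longrightarrow> s < d' \<Longrightarrow> s \<le> d"
    proof (cases "\<exists>d\<in>J. t < d")
      case True
      then obtain d where "d \<in> J" "t < d" by blast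
      then show thesis
        by (intro that[of "max d t0" d]) (use t0 in \<open>auto simp: max_def\<close>)
    next
      case False
      then show thesis
        by (intro that[of t "t + 1"]) (use t t0 in \<open>auto simp: not_less\<close>)
    qed
    have sub: "{c..d} \<subseteq> J"
      using mem_is_interval_1_I[OF J c(1) d(1)] by auto
    have "at t within J = at t within {c..d}"
    proof (rule at_within_nhd)
      show "t \<in> {c'<..<d'}" using c d by simp
      show "J \<inter> {c'<..<d'} - {t} = {c..d} \<inter> {c'<..<d'} - {t}"
        using sub c(5) d(5) by auto
    qed simp
    moreover have "((\<lambda>u. LBINT y=ereal t0..ereal u. f y) has_vector_derivative f t) (at t within {c..d})"
      using c d sub by (intro interval_integral_FTC2 continuous_on_subset[OF f]) auto
    ultimately show ?thesis
      by (simp add: has_real_derivative_iff_has_vector_derivative)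
  qed
  then show ?thesis by blast
qed simp

lemma interval_integral_lincomb:
  fixes f g :: "real \<Rightarrow> real"
  assumes "a \<le> b" "continuous_on {a..b} f" "continuous_on {a..b} g"
  shows "(LBINT s=ereal a..ereal b. r * f s + r' * g s)
    = r * (LBINT s=ereal a..ereal b. f s) + r' * (LBINT s=ereal a..ereal b. g s)"
  using assms by (simp add: interval_integrable_continuous_on)

section \<open>The first-order system, superposition and Wronskians\<close>

definition first_order_system ::
  "(real \<Rightarrow> real) \<Rightarrow> (real \<Rightarrow> real) \<Rightarrow> (real \<Rightarrow> real) \<Rightarrow> (real \<Rightarrow> real) \<Rightarrow> real set \<Rightarrow>
   (real \<Rightarrow> real) \<Rightarrow> (real \<Rightarrow> real) \<Rightarrow> (real \<Rightarrow> real) \<Rightarrow> bool" where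
  "first_order_system k0 k1 p q J h x y \<longleftrightarrow>
     (\<forall>t\<in>J. (x has_real_derivative (y t / p t - k1 t * x t) / k0 t) (at t within J) \<and>
            (y has_real_derivative (h t - q t * x t - k1 t * y t) / k0 t) (at t within J))"

lemma first_order_system_subset:
  assumes "first_order_system k0 k1 p q I h x y" "J \<subseteq> I"
  shows "first_order_system k0 k1 p q J h x y"
  using assms unfolding first_order_system_def by (meson has_field_derivative_subset subsetD)

text \<open>Used for functions known only through their values on \<open>J\<close>, such as
  \<open>u\<close> or the Green integral.\<close>

lemma first_order_system_cong:
  assumes "first_order_system k0 k1 p q J h x y" "\<And>t. t \<in> J \<Longrightarrow> x t = x' t"
  shows "first_order_system k0 k1 p q J h x' y"
  unfolding first_order_system_def
proof (intro ballI conjI)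
  fix t assume t: "t \<in> J"
  show "(x' has_real_derivative (y t / p t - k1 t * x' t) / k0 t) (at t within J)"
    by (rule has_field_derivative_transform_within[where d = 1 and f = x])
       (use assms t in \<open>auto simp: first_order_system_def\<close>)
  show "(y has_real_derivative (h t - q t * x' t - k1 t * y t) / k0 t) (at t within J)"
    using assms t by (auto simp: first_order_system_def)
qed

text \<open>By the product rule, the terms with \<open>A\<close> and \<open>B\<close> reproduce the
  system with right-hand side \<open>A * h1 + B * h2\<close>. The terms with \<open>A'\<close> and
  \<open>B'\<close> must then vanish in the first equation and supply the rest of \<open>h\<close>
  in the second. Constant coefficients give superposition; \<open>h1 = h2 = 0\<close> gives
  variation of parameters.\<close>

lemma first_order_system_variation:
  assumes k0: "\<And>t. t \<in> J \<Longrightarrow> k0 t \<noteq> 0"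
    and 1: "first_order_system k0 k1 p q J h1 x1 y1"
    and 2: "first_order_system k0 k1 p q J h2 x2 y2"
    and A: "\<And>t. t \<in> J \<Longrightarrow> (A has_real_derivative A' t) (at t within J)"
    and B: "\<And>t. t \<in> J \<Longrightarrow> (B has_real_derivative B' t) (at t within J)"
    and "\<And>t. t \<in> J \<Longrightarrow> x1 t * A' t + x2 t * B' t = 0"
    and "\<And>t. t \<in> J \<Longrightarrow> k0 t * (y1 t * A' t + y2 t * B' t) = h t - (A t * h1 t + B t * h2 t)"
  shows "first_order_system k0 k1 p q J h (\<lambda>t. A t * x1 t + B t * x2 t) (\<lambda>t. A t * y1 t + B t * y2 t)"
  unfolding first_order_system_def
proof (intro ballI conjI)
  fix t assume t: "t \<in> J"
  note d = 1[unfolded first_order_system_def, rule_format, OF t]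
           2[unfolded first_order_system_def, rule_format, OF t]
  have x': "x1 t * A' t + x2 t * B' t = 0"
    and y': "y1 t * A' t + y2 t * B' t = (h t - (A t * h1 t + B t * h2 t)) / k0 t"
    using assms(6,7)[OF t] k0[OF t] by (simp_all add: eq_divide_eq mult.commute)
  have "((\<lambda>t. A t * x1 t + B t * x2 t) has_real_derivative
      A' t * x1 t + (y1 t / p t - k1 t * x1 t) / k0 t * A t
      + (B' t * x2 t + (y2 t / p t - k1 t * x2 t) / k0 t * B t)) (at t within J)"
    using d A[OF t] B[OF t] by (intro DERIV_add DERIV_mult) auto
  moreover have "A' t * x1 t + (y1 t / p t - k1 t * x1 t) / k0 t * A t
      + (B' t * x2 t + (y2 t / p t - k1 t * x2 t) / k0 t * B t)
    = (x1 t * A' t + x2 t * B' t)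
      + ((A t * y1 t + B t * y2 t) / p t - k1 t * (A t * x1 t + B t * x2 t)) / k0 t"
    by (simp add: add_divide_distrib diff_divide_distrib algebra_simps)
  ultimately show "((\<lambda>t. A t * x1 t + B t * x2 t) has_real_derivative
      ((A t * y1 t + B t * y2 t) / p t - k1 t * (A t * x1 t + B t * x2 t)) / k0 t) (at t within J)"
    unfolding x' by simp
  have "((\<lambda>t. A t * y1 t + B t * y2 t) has_real_derivative
      A' t * y1 t + (h1 t - q t * x1 t - k1 t * y1 t) / k0 t * A t
      + (B' t * y2 t + (h2 t - q t * x2 t - k1 t * y2 t) / k0 t * B t)) (at t within J)"
    using d A[OF t] B[OF t] by (intro DERIV_add DERIV_mult) auto
  moreover have "A' t * y1 t + (h1 t - q t * x1 t - k1 t * y1 t) / k0 t * A t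
      + (B' t * y2 t + (h2 t - q t * x2 t - k1 t * y2 t) / k0 t * B t)
    = (y1 t * A' t + y2 t * B' t)
      + (A t * h1 t + B t * h2 t - q t * (A t * x1 t + B t * x2 t) - k1 t * (A t * y1 t + B t * y2 t)) / k0 t"
    by (simp add: add_divide_distrib diff_divide_distrib algebra_simps)
  moreover have eq: "(y1 t * A' t + y2 t * B' t)
      + (A t * h1 t + B t * h2 t - q t * (A t * x1 t + B t * x2 t) - k1 t * (A t * y1 t + B t * y2 t)) / k0 t
    = (h t - q t * (A t * x1 t + B t * x2 t) - k1 t * (A t * y1 t + B t * y2 t)) / k0 t"
    unfolding y' by (simp add: add_divide_distrib diff_divide_distrib)
  ultimately show "((\<lambda>t. A t * y1 t + B t * y2 t) has_real_derivative
      (h t - q t * (A t * x1 t + B t * x2 t) - k1 t * (A t * y1 t + B t * y2 t)) / k0 t) (at t within J)"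
    by (simp only: eq)
qed

corollary first_order_system_linear:
  assumes "\<And>t. t \<in> J \<Longrightarrow> k0 t \<noteq> 0"
    and "first_order_system k0 k1 p q J h1 x1 y1" "first_order_system k0 k1 p q J h2 x2 y2"
  shows "first_order_system k0 k1 p q J (\<lambda>t. A * h1 t + B * h2 t)
    (\<lambda>t. A * x1 t + B * x2 t) (\<lambda>t. A * y1 t + B * y2 t)"
  by (rule first_order_system_variation[OF assms, of "\<lambda>_. A" "\<lambda>_. 0" "\<lambda>_. B" "\<lambda>_. 0"]) auto

text \<open>Abel's formula: the Wronskian solves \<open>w' = - 2 (k1 / k0) w\<close>.\<close>

lemma wronskian_const:
  fixes F :: "real \<Rightarrow> real"
  assumes "convex J"
    and F: "\<And>t. t \<in> J \<Longrightarrow> (F has_real_derivative k1 t / k0 t) (at t within J)"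
    and 1: "first_order_system k0 k1 p q J (\<lambda>_. 0) x1 y1"
    and 2: "first_order_system k0 k1 p q J (\<lambda>_. 0) x2 y2"
  shows "\<exists>c. \<forall>t\<in>J. exp (2 * F t) * (x1 t * y2 t - x2 t * y1 t) = c"
proof (rule has_field_derivative_zero_constant[OF \<open>convex J\<close>])
  fix t assume t: "t \<in> J"
  note d1 = 1[unfolded first_order_system_def, rule_format, OF t]
  note d2 = 2[unfolded first_order_system_def, rule_format, OF t]
  have "((\<lambda>t. exp (2 * F t) * (x1 t * y2 t - x2 t * y1 t)) has_real_derivative
     (exp (2 * F t) * (2 * (k1 t / k0 t))) * (x1 t * y2 t - x2 t * y1 t)
     + (((y1 t / p t - k1 t * x1 t) / k0 t * y2 t + (0 - q t * x2 t - k1 t * y2 t) / k0 t * x1 t)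
       - ((y2 t / p t - k1 t * x2 t) / k0 t * y1 t + (0 - q t * x1 t - k1 t * y1 t) / k0 t * x2 t))
       * exp (2 * F t)) (at t within J)"
    by (rule derivative_eq_intros refl d1[THEN conjunct1] d1[THEN conjunct2] d2[THEN conjunct1]
      d2[THEN conjunct2] F[OF t])+ (simp add: algebra_simps)
  \<comment> \<open>The terms with \<open>1 / p\<close> and with \<open>q\<close> cancel by
    antisymmetry. The remaining ones give \<open>- 2 * (k1 / k0)\<close> times the Wronskian, offset
    by the derivative of the exponential factor.\<close>
  moreover have "(exp (2 * F t) * (2 * (k1 t / k0 t))) * (x1 t * y2 t - x2 t * y1 t)
     + (((y1 t / p t - k1 t * x1 t) / k0 t * y2 t + (0 - q t * x2 t - k1 t * y2 t) / k0 t * x1 t)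
       - ((y2 t / p t - k1 t * x2 t) / k0 t * y1 t + (0 - q t * x1 t - k1 t * y1 t) / k0 t * x2 t))
       * exp (2 * F t) = 0"
    by (simp add: divide_inverse algebra_simps)
  ultimately show "((\<lambda>t. exp (2 * F t) * (x1 t * y2 t - x2 t * y1 t)) has_real_derivative 0) (at t within J)"
    by (simp only:)
qed

section \<open>The conformable equation and its equivalence with the system\<close>

locale conformable_equation =
  fixes I :: "real set" and \<kappa>0 \<kappa>1 :: "real \<Rightarrow> real \<Rightarrow> real" and \<alpha> :: real and p q :: "real \<Rightarrow> real"
  assumes interval: "is_interval I" and nondegenerate: "\<exists>c\<in>I. \<exists>d\<in>I. c \<noteq> d"
    and cont_k0: "continuous_on I (\<kappa>0 \<alpha>)" and cont_k1: "continuous_on I (\<kappa>1 \<alpha>)"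
    and k0_pos: "\<And>t. t \<in> I \<Longrightarrow> \<kappa>0 \<alpha> t > 0"
    and cont_p: "continuous_on I p" and cont_q: "continuous_on I q"
    and p_pos: "\<And>t. t \<in> I \<Longrightarrow> p t > 0"
begin

abbreviation D where "D \<equiv> conf_deriv \<kappa>0 \<kappa>1 \<alpha>"
abbreviation solution where "solution \<equiv> conf_solution \<kappa>0 \<kappa>1 \<alpha> p q"
abbreviation system where "system \<equiv> first_order_system (\<kappa>0 \<alpha>) (\<kappa>1 \<alpha>) p q"

lemma k0_nz: "t \<in> I \<Longrightarrow> \<kappa>0 \<alpha> t \<noteq> 0" and p_nz: "t \<in> I \<Longrightarrow> p t \<noteq> 0"
  using k0_pos p_pos by force+

text \<open>The equation is considered on \<open>I\<close> for the Cauchy function and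
  \<open>u\<close>, but on \<open>{a..b}\<close> for the periodic problem. Derivatives within
  \<open>J\<close> depend on \<open>J\<close>, so one notion covers both cases.\<close>

definition subinterval where
  "subinterval J \<longleftrightarrow> J \<subseteq> I \<and> is_interval J \<and> (\<exists>c\<in>J. \<exists>d\<in>J. c \<noteq> d)"

lemma subinterval_self: "subinterval I"
  using interval nondegenerate by (simp add: subinterval_def)

lemma subinterval_Icc: "a < b \<Longrightarrow> {a..b} \<subseteq> I \<Longrightarrow> subinterval {a..b}"
  unfolding subinterval_def by (metis atLeastAtMost_iff is_interval_cc less_le order_refl)

lemma D_eq:
  assumes "subinterval J" "t \<in> J" "(f has_real_derivative f') (at t within J)"
  shows "D J f t = \<kappa>1 \<alpha> t * f t + \<kappa>0 \<alpha> t * f'"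
  using assms vector_derivative_within_interval_eq
  unfolding subinterval_def conf_deriv_def by metis

text \<open>The first equation of the system is this formula solved for the derivative of
  \<open>x\<close>. It turns boundary conditions on conformable derivatives into conditions on
  \<open>y / p\<close>.\<close>

lemma system_D:
  assumes J: "subinterval J" and s: "system J h x y" and t: "t \<in> J"
  shows "D J x t = y t / p t"
proof -
  have "D J x t = \<kappa>1 \<alpha> t * x t + \<kappa>0 \<alpha> t * ((y t / p t - \<kappa>1 \<alpha> t * x t) / \<kappa>0 \<alpha> t)"
    using s t by (intro D_eq[OF J t]) (simp add: first_order_system_def)
  then show ?thesis
    using J t k0_nz[of t] by (auto simp: subinterval_def)
qed

lemma system_continuous:
  assumes "system J h x y"
  shows "continuous_on J x" "continuous_on J y"
  using assms unfolding first_order_system_def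
  by (auto intro!: continuous_on_vector_derivative
      simp: has_real_derivative_iff_has_vector_derivative)

lemma solution_imp_system:
  assumes J: "subinterval J" and x: "solution J h x"
  shows "system J h x (\<lambda>t. p t * D J x t)"
  unfolding first_order_system_def
proof (intro ballI)
  fix t assume t: "t \<in> J"
  then have tI: "t \<in> I" using J by (auto simp: subinterval_def)
  let ?y = "\<lambda>t. p t * D J x t"
  obtain x' where x': "(x has_real_derivative x') (at t within J)"
    using x t unfolding conf_solution_def Let_def real_differentiable_def by blast
  obtain y' where y': "(?y has_real_derivative y') (at t within J)"
    using x t unfolding conf_solution_def Let_def real_differentiable_def by blast
  have "D J ?y t + q t * x t = h t"
    using x t unfolding conf_solution_def Let_def conf_L_def by blast
  then have "y' = (h t - q t * x t - \<kappa>1 \<alpha> t * ?y t) / \<kappa>0 \<alpha> t"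
    using D_eq[OF J t y'] k0_nz[OF tI] by (simp add: field_simps)
  moreover have "x' = (?y t / p t - \<kappa>1 \<alpha> t * x t) / \<kappa>0 \<alpha> t"
    using D_eq[OF J t x'] k0_nz[OF tI] p_nz[OF tI] by (simp add: field_simps)
  ultimately show "(x has_real_derivative (?y t / p t - \<kappa>1 \<alpha> t * x t) / \<kappa>0 \<alpha> t) (at t within J) \<and>
      (?y has_real_derivative (h t - q t * x t - \<kappa>1 \<alpha> t * ?y t) / \<kappa>0 \<alpha> t) (at t within J)"
    using x' y' by simp
qed

text \<open>Along the system, \<open>D J x\<close> is \<open>y / p\<close> and \<open>D J\<close> of
  \<open>p * D J x\<close> is \<open>h - q * x\<close>; both expressions are continuous on
  \<open>J\<close>.\<close>

lemma system_imp_solution: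
  assumes J: "subinterval J" and h: "continuous_on J h" and s: "system J h x y"
  shows "solution J h x"
proof -
  have JI: "J \<subseteq> I" using J by (simp add: subinterval_def)
  note c = system_continuous[OF s]
  note D = system_D[OF J s]
  have pD: "p t * D J x t = y t" if "t \<in> J" for t
    using D that JI p_nz by auto
  have der: "((\<lambda>t. p t * D J x t) has_real_derivative
      (h t - q t * x t - \<kappa>1 \<alpha> t * y t) / \<kappa>0 \<alpha> t) (at t within J)" if t: "t \<in> J" for t
    by (rule has_field_derivative_transform_within[where d = 1 and f = y])
       (use s t pD in \<open>auto simp: first_order_system_def\<close>)
  have DD: "D J (\<lambda>t. p t * D J x t) t = h t - q t * x t" if t: "t \<in> J" for t
    using D_eq[OF J t der[OF t]] pD[OF t] k0_nz[of t] t JI by auto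
  have "continuous_on J (\<lambda>t. y t / p t)"
    using c continuous_on_subset[OF cont_p JI] p_nz JI by (intro continuous_on_divide) auto
  then have "continuous_on J (D J x)"
    by (rule continuous_on_eq) (simp add: D)
  moreover have "continuous_on J (\<lambda>t. h t - q t * x t)"
    using c h continuous_on_subset[OF cont_q JI] by (intro continuous_on_diff continuous_on_mult)
  then have "continuous_on J (D J (\<lambda>t. p t * D J x t))"
    by (rule continuous_on_eq) (simp add: DD)
  moreover have "\<forall>t\<in>J. x differentiable (at t within J)"
    using s unfolding first_order_system_def real_differentiable_def by blast
  moreover have "\<forall>t\<in>J. (\<lambda>t. p t * D J x t) differentiable (at t within J)"
    using der unfolding real_differentiable_def by blast
  ultimately show ?thesis
    using c(1) DD unfolding conf_solution_def Let_def conf_L_def by simp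
qed

lemma solution_iff:
  assumes "subinterval J" "continuous_on J h"
  shows "solution J h x \<longleftrightarrow> (\<exists>y. system J h x y)"
  using assms solution_imp_system system_imp_solution by blast

text \<open>A section of the Cauchy function vanishing identically would have zero slope on the diagonal,
  so some \<open>s2\<close> makes the Wronskian of the sections at \<open>s1\<close> and \<open>s2\<close> nonzero at \<open>s2\<close>, hence
  everywhere.\<close>

lemma cauchy_fundamental_system:
  assumes X: "cauchy_function \<kappa>0 \<kappa>1 \<alpha> p q I X"
  obtains x1 y1 x2 y2 where "system I (\<lambda>_. 0) x1 y1" "system I (\<lambda>_. 0) x2 y2"
    "\<And>t. t \<in> I \<Longrightarrow> x1 t * y2 t - x2 t * y1 t \<noteq> 0"
proof -
  define Y where "Y = (\<lambda>t s. p t * D I (\<lambda>t. X t s) t)"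
  have sys: "system I (\<lambda>_. 0) (\<lambda>t. X t s) (\<lambda>t. Y t s)" if "s \<in> I" for s
    using X that solution_imp_system[OF subinterval_self] by (simp add: cauchy_function_def Y_def)
  have diag: "X s s = 0" "Y s s = 1" if "s \<in> I" for s
    using X that p_nz by (auto simp: cauchy_function_def Y_def)
  obtain s1 where s1: "s1 \<in> I" using nondegenerate by blast
  obtain s2 where s2: "s2 \<in> I" "X s2 s1 \<noteq> 0"
  proof (rule ccontr)
    assume "\<not> thesis"
    with that have 0: "X t s1 = 0" if "t \<in> I" for t using \<open>t \<in> I\<close> by blast
    have "((\<lambda>t. X t s1) has_real_derivative 0) (at s1 within I)"
      by (rule has_field_derivative_transform_within[where d = 1 and f = "\<lambda>_. 0"])
         (use s1 0 in auto)
    then have "D I (\<lambda>t. X t s1) s1 = 0"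
      using D_eq[OF subinterval_self s1] 0[OF s1] by fastforce
    then show False using diag(2)[OF s1] by (simp add: Y_def)
  qed
  obtain F where "\<forall>t\<in>I. (F has_real_derivative \<kappa>1 \<alpha> t / \<kappa>0 \<alpha> t) (at t within I)"
    using interval_antiderivative_exists[OF interval, of "\<lambda>t. \<kappa>1 \<alpha> t / \<kappa>0 \<alpha> t"]
      continuous_on_divide[OF cont_k1 cont_k0] k0_nz by blast
  then obtain c where c: "\<forall>t\<in>I. exp (2 * F t) * (X t s1 * Y t s2 - X t s2 * Y t s1) = c"
    using wronskian_const[of I F "\<kappa>1 \<alpha>" "\<kappa>0 \<alpha>", OF _ _ sys[OF s1] sys[OF s2(1)]]
      is_interval_convex[OF interval] by auto
  \<comment> \<open>At \<open>s2\<close> the second section has value 0 and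
    \<open>Y s2 s2 = 1\<close>, so the Wronskian there is \<open>X s2 s1\<close>.\<close>
  then have "c \<noteq> 0" using s2 diag[OF s2(1)] by force
  then have "X t s1 * Y t s2 - X t s2 * Y t s1 \<noteq> 0" if "t \<in> I" for t
    using c that by force
  with sys[OF s1] sys[OF s2(1)] show thesis by (rule that)
qed

end

section \<open>Representation by a fundamental system\<close>

locale fundamental_system = conformable_equation +
  fixes x1 y1 x2 y2 :: "real \<Rightarrow> real"
  assumes sys1: "system I (\<lambda>_. 0) x1 y1" and sys2: "system I (\<lambda>_. 0) x2 y2"
    and wronskian_nz: "\<And>t. t \<in> I \<Longrightarrow> x1 t * y2 t - x2 t * y1 t \<noteq> 0"
begin

lemma system_combination: "system I (\<lambda>_. 0) (\<lambda>t. c1 * x1 t + c2 * x2 t) (\<lambda>t. c1 * y1 t + c2 * y2 t)"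
  using first_order_system_linear[OF k0_nz sys1 sys2, of c1 c2] by simp

text \<open>Cramer's rule with Wronskians: the coefficients \<open>c1\<close>, \<open>c2\<close> are quotients of two Wronskians, and
  these quotients are constant by Abel's formula.\<close>

lemma system_representation:
  assumes J: "subinterval J" and s: "system J (\<lambda>_. 0) x y"
  obtains c1 c2 where "\<And>t. t \<in> J \<Longrightarrow> x t = c1 * x1 t + c2 * x2 t"
    "\<And>t. t \<in> J \<Longrightarrow> y t = c1 * y1 t + c2 * y2 t"
proof -
  have JI: "J \<subseteq> I" and "convex J" and "J \<noteq> {}"
    using J by (auto simp: subinterval_def is_interval_convex)
  then obtain t0 where t0: "t0 \<in> J" by blast
  obtain F where F: "\<And>t. t \<in> J \<Longrightarrow> (F has_real_derivative \<kappa>1 \<alpha> t / \<kappa>0 \<alpha> t) (at t within J)"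
    using interval_antiderivative_exists[of J "\<lambda>t. \<kappa>1 \<alpha> t / \<kappa>0 \<alpha> t"]
      continuous_on_subset[OF continuous_on_divide[OF cont_k1 cont_k0] JI] k0_nz J
    unfolding subinterval_def by blast
  note const = wronskian_const[OF \<open>convex J\<close> F]
  note s1 = first_order_system_subset[OF sys1 JI] and s2 = first_order_system_subset[OF sys2 JI]
  obtain A where A: "\<And>t. t \<in> J \<Longrightarrow> exp (2 * F t) * (x t * y2 t - x2 t * y t) = A"
    using const[OF _ s s2] by blast
  obtain B where B: "\<And>t. t \<in> J \<Longrightarrow> exp (2 * F t) * (x1 t * y t - x t * y1 t) = B"
    using const[OF _ s1 s] by blast
  obtain C where C: "\<And>t. t \<in> J \<Longrightarrow> exp (2 * F t) * (x1 t * y2 t - x2 t * y1 t) = C"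
    using const[OF _ s1 s2] by blast
  have "C \<noteq> 0" using C[OF t0] wronskian_nz t0 JI by force
  show thesis
  proof (rule that[of "A / C" "B / C"])
    fix t assume t: "t \<in> J"
    \<comment> \<open>With the constants rewritten as Wronskians at \<open>t\<close> itself, both
      claims are polynomial identities.\<close>
    have "C * x t = A * x1 t + B * x2 t" "C * y t = A * y1 t + B * y2 t"
      by (simp_all flip: A[OF t] B[OF t] C[OF t] add: algebra_simps)
    then show "x t = A / C * x1 t + B / C * x2 t" "y t = A / C * y1 t + B / C * y2 t"
      using \<open>C \<noteq> 0\<close> by (simp_all add: field_simps)
  qed
qed

text \<open>Cramer's rule for the combination of \<open>x1\<close> and \<open>x2\<close> with value
  0 and second component 1 at \<open>s\<close>, that is, for the section of the Cauchy function at
  \<open>s\<close>. The same two equations are those of variation of parameters.\<close>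

definition c1 where "c1 s = - x2 s / (x1 s * y2 s - x2 s * y1 s)"
definition c2 where "c2 s = x1 s / (x1 s * y2 s - x2 s * y1 s)"

lemma c_diag:
  assumes "s \<in> I"
  shows "x1 s * c1 s + x2 s * c2 s = 0" "y1 s * c1 s + y2 s * c2 s = 1"
proof -
  show "x1 s * c1 s + x2 s * c2 s = 0" by (simp add: c1_def c2_def)
  have "y1 s * c1 s + y2 s * c2 s = (x1 s * y2 s - x2 s * y1 s) / (x1 s * y2 s - x2 s * y1 s)"
    unfolding c1_def c2_def times_divide_eq_right add_divide_distrib[symmetric]
    by (simp add: algebra_simps)
  then show "y1 s * c1 s + y2 s * c2 s = 1" using wronskian_nz[OF assms] by simp
qed

lemma continuous_c: "continuous_on I c1" "continuous_on I c2"
  unfolding c1_def c2_def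
  using system_continuous[OF sys1] system_continuous[OF sys2] wronskian_nz
  by (intro continuous_on_divide continuous_on_minus continuous_on_diff continuous_on_mult; simp)+

lemma cauchy_representation:
  assumes X: "cauchy_function \<kappa>0 \<kappa>1 \<alpha> p q I X" and s: "s \<in> I" and t: "t \<in> I"
  shows "X t s = c1 s * x1 t + c2 s * x2 t"
    "D I (\<lambda>t. X t s) t = (c1 s * y1 t + c2 s * y2 t) / p t"
proof -
  let ?Y = "\<lambda>t. p t * D I (\<lambda>t. X t s) t" and ?W = "x1 s * y2 s - x2 s * y1 s"
  have "system I (\<lambda>_. 0) (\<lambda>t. X t s) ?Y"
    using X s solution_imp_system[OF subinterval_self] by (simp add: cauchy_function_def)
  then obtain b1 b2 where b: "\<And>t. t \<in> I \<Longrightarrow> X t s = b1 * x1 t + b2 * x2 t"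
      "\<And>t. t \<in> I \<Longrightarrow> ?Y t = b1 * y1 t + b2 * y2 t"
    using system_representation[OF subinterval_self] by blast
  have 0: "b1 * x1 s + b2 * x2 s = 0" and 1: "b1 * y1 s + b2 * y2 s = 1"
    using b[OF s] X s p_nz[OF s] by (simp_all add: cauchy_function_def)
  have "b1 * ?W = y2 s * (b1 * x1 s + b2 * x2 s) - x2 s * (b1 * y1 s + b2 * y2 s)"
    "b2 * ?W = x1 s * (b1 * y1 s + b2 * y2 s) - y1 s * (b1 * x1 s + b2 * x2 s)"
    by (simp_all add: algebra_simps)
  then have "b1 = c1 s" "b2 = c2 s"
    using wronskian_nz[OF s] nonzero_mult_div_cancel_right[of ?W b1]
      nonzero_mult_div_cancel_right[of ?W b2] unfolding 0 1 c1_def c2_def by simp_all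
  then show "X t s = c1 s * x1 t + c2 s * x2 t"
    "D I (\<lambda>t. X t s) t = (c1 s * y1 t + c2 s * y2 t) / p t"
    using b[OF t] p_nz[OF t] by (simp_all add: field_simps)
qed

end

section \<open>Periodic boundary conditions and the function \<open>u\<close>\<close>

locale periodic_problem = fundamental_system +
  fixes a b E :: real
  assumes ab: "a < b" "{a..b} \<subseteq> I"
    and E: "E = conf_exp0 \<kappa>0 \<kappa>1 \<alpha> a b"
    and trivial: "\<And>x. periodic_bvp \<kappa>0 \<kappa>1 \<alpha> p q a b (\<lambda>_. 0) x \<Longrightarrow> \<forall>t\<in>{a..b}. x t = 0"
begin

text \<open>The boundary conditions as linear functionals. The second is applied to
  \<open>y\<close>, which is \<open>p\<close> times the conformable derivative of \<open>x\<close>,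
  so it contains no derivative and is linear on arbitrary functions.\<close>

definition bd1 where "bd1 x = x a - E * x b"
definition bd2 where "bd2 y = y a / p a - E * (y b / p b)"

lemma ab_mem: "a \<in> I" "b \<in> I"
  using ab by auto

lemma bd_linear:
  "bd1 (\<lambda>t. r * f t + s * g t) = r * bd1 f + s * bd1 g"
  "bd2 (\<lambda>t. r * f t + s * g t) = r * bd2 f + s * bd2 g"
  by (simp_all add: bd1_def bd2_def add_divide_distrib algebra_simps)

lemma periodic_bvp_iff:
  assumes h: "continuous_on {a..b} h"
  shows "periodic_bvp \<kappa>0 \<kappa>1 \<alpha> p q a b h x \<longleftrightarrow>
    (\<exists>y. system {a..b} h x y \<and> bd1 x = 0 \<and> bd2 y = 0)"
proof -
  note J = subinterval_Icc[OF ab]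
  have D: "D {a..b} x a = y a / p a" "D {a..b} x b = y b / p b" if "system {a..b} h x y" for y
    using system_D[OF J that] ab by auto
  show ?thesis
    unfolding periodic_bvp_def Let_def E[symmetric] solution_iff[OF J h] bd1_def bd2_def
    using D by auto
qed

definition bd_det where "bd_det = bd1 x1 * bd2 y2 - bd1 x2 * bd2 y1"

text \<open>A kernel vector of the boundary matrix gives a combination of \<open>x1\<close> and
  \<open>x2\<close> that solves the homogeneous problem. By \<open>trivial\<close> this combination
  vanishes, and then so does the vector.\<close>

lemma bd_det_nz: "bd_det \<noteq> 0"
proof
  assume 0: "bd_det = 0"
  have no_kernel: "r = 0 \<and> s = 0" if "r * bd1 x1 + s * bd1 x2 = 0" "r * bd2 y1 + s * bd2 y2 = 0" for r s
  proof -
    let ?x = "\<lambda>t. r * x1 t + s * x2 t" and ?y = "\<lambda>t. r * y1 t + s * y2 t"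
    have sys: "system {a..b} (\<lambda>_. 0) ?x ?y"
      using first_order_system_subset[OF system_combination ab(2)] .
    have "bd1 ?x = 0" "bd2 ?y = 0"
      using that by (simp_all add: bd_linear)
    with sys have x0: "?x t = 0" if "t \<in> {a..b}" for t
      using trivial[of ?x] periodic_bvp_iff[OF continuous_on_const, of 0 ?x] that by blast
    \<comment> \<open>With the zero function as first component, \<open>?y a / p a\<close> is the
      conformable derivative of zero at \<open>a\<close>. Once both components vanish at
      \<open>a\<close>, the Wronskian there forces \<open>r = s = 0\<close>.\<close>
    then have "system {a..b} (\<lambda>_. 0) (\<lambda>_. 0) ?y"
      by (rule first_order_system_cong[OF sys])
    moreover have "D {a..b} (\<lambda>_. 0) a = 0"
      using D_eq[OF subinterval_Icc[OF ab], of a "\<lambda>_. 0" 0] ab by simp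
    ultimately have ya: "?y a = 0"
      using system_D[OF subinterval_Icc[OF ab], of "\<lambda>_. 0" "\<lambda>_. 0" ?y a] ab p_nz[OF ab_mem(1)] by auto
    have xa: "?x a = 0" using x0 ab by simp
    have "r * (x1 a * y2 a - x2 a * y1 a) = y2 a * ?x a - x2 a * ?y a"
      "s * (x1 a * y2 a - x2 a * y1 a) = x1 a * ?y a - y1 a * ?x a"
      by (simp_all add: algebra_simps)
    then show ?thesis using wronskian_nz[OF ab_mem(1)] unfolding xa ya by simp
  qed
  \<comment> \<open>For a singular matrix the columns of the adjugate lie, up to sign, in the
    kernel. They must be zero, so the whole matrix is zero and has the kernel vector
    \<open>(1, 0)\<close>, a contradiction.\<close>
  have "bd2 y2 = 0 \<and> bd2 y1 = 0"
    using no_kernel[of "bd2 y2" "- bd2 y1"] 0 by (simp add: bd_det_def mult.commute)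
  moreover have "bd1 x2 = 0 \<and> bd1 x1 = 0"
    using no_kernel[of "bd1 x2" "- bd1 x1"] 0 by (simp add: bd_det_def mult.commute)
  ultimately show False using no_kernel[of 1 0] by simp
qed

text \<open>\<open>R1 s\<close> and \<open>R2 s\<close> are \<open>E\<close> times the value and the
  conformable derivative at \<open>b\<close> of the Cauchy section at \<open>s\<close>: the data in
  the boundary conditions for \<open>u\<close>. Cramer's rule then gives the coefficients
  \<open>d1 s\<close>, \<open>d2 s\<close> of \<open>u\<close>.\<close>

definition R1 where "R1 s = E * (c1 s * x1 b + c2 s * x2 b)"
definition R2 where "R2 s = E * ((c1 s * y1 b + c2 s * y2 b) / p b)"
definition d1 where "d1 s = (R1 s * bd2 y2 - bd1 x2 * R2 s) / bd_det"
definition d2 where "d2 s = (bd1 x1 * R2 s - R1 s * bd2 y1) / bd_det"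

text \<open>Both directions follow after multiplying by the nonzero \<open>bd_det\<close>. From left
  to right this yields uniqueness of \<open>u\<close>, from right to left its existence.\<close>

lemma d_iff:
  "e1 * bd1 x1 + e2 * bd1 x2 = R1 s \<and> e1 * bd2 y1 + e2 * bd2 y2 = R2 s \<longleftrightarrow> e1 = d1 s \<and> e2 = d2 s"
  (is "?l \<longleftrightarrow> ?r")
proof
  assume ?l
  then have R: "R1 s = e1 * bd1 x1 + e2 * bd1 x2" "R2 s = e1 * bd2 y1 + e2 * bd2 y2" by simp_all
  have "d1 s * bd_det = R1 s * bd2 y2 - bd1 x2 * R2 s" "d2 s * bd_det = bd1 x1 * R2 s - R1 s * bd2 y1"
    using bd_det_nz by (simp_all add: d1_def d2_def)
  then have "d1 s * bd_det = e1 * bd_det" "d2 s * bd_det = e2 * bd_det"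
    unfolding R by (simp_all add: bd_det_def algebra_simps)
  then show ?r using bd_det_nz by simp
next
  assume ?r
  then have e: "e1 * bd_det = R1 s * bd2 y2 - bd1 x2 * R2 s" "e2 * bd_det = bd1 x1 * R2 s - R1 s * bd2 y1"
    using bd_det_nz by (simp_all add: d1_def d2_def)
  have "(e1 * bd1 x1 + e2 * bd1 x2) * bd_det = (e1 * bd_det) * bd1 x1 + (e2 * bd_det) * bd1 x2"
    "(e1 * bd2 y1 + e2 * bd2 y2) * bd_det = (e1 * bd_det) * bd2 y1 + (e2 * bd_det) * bd2 y2"
    by (simp_all add: algebra_simps)
  then have "(e1 * bd1 x1 + e2 * bd1 x2) * bd_det = R1 s * bd_det"
    "(e1 * bd2 y1 + e2 * bd2 y2) * bd_det = R2 s * bd_det"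
    unfolding e by (simp_all add: bd_det_def algebra_simps)
  then show ?l using bd_det_nz by simp
qed

lemma continuous_d: "continuous_on I d1" "continuous_on I d2"
  unfolding d1_def d2_def R1_def R2_def
  by (intro continuous_intros continuous_c; use bd_det_nz p_nz ab_mem in simp)+

text \<open>Every homogeneous solution is a combination of \<open>x1\<close> and \<open>x2\<close>,
  and for such a combination the boundary conditions are the linear system of
  \<open>d_iff\<close>.\<close>

lemma shifted_iff:
  assumes X: "cauchy_function \<kappa>0 \<kappa>1 \<alpha> p q I X" and s: "s \<in> I"
  shows "shifted_periodic_bvp \<kappa>0 \<kappa>1 \<alpha> p q I a b (\<lambda>t. X t s) u \<longleftrightarrow>
    (\<forall>t\<in>I. u t = d1 s * x1 t + d2 s * x2 t)"
proof -
  note J = subinterval_self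
  have bc: "shifted_periodic_bvp \<kappa>0 \<kappa>1 \<alpha> p q I a b (\<lambda>t. X t s) u \<longleftrightarrow> bd1 u = R1 s \<and> bd2 y = R2 s"
    if "system I (\<lambda>_. 0) u y" for y
  proof -
    have "solution I (\<lambda>_. 0) u" using that solution_iff[OF J] by auto
    then show ?thesis
      unfolding shifted_periodic_bvp_def Let_def E[symmetric] bd1_def bd2_def R1_def R2_def
      using system_D[OF J that] cauchy_representation[OF X s] ab_mem
      by (auto simp: algebra_simps)
  qed
  show ?thesis
  proof
    assume u: "shifted_periodic_bvp \<kappa>0 \<kappa>1 \<alpha> p q I a b (\<lambda>t. X t s) u"
    then obtain y where y: "system I (\<lambda>_. 0) u y"
      using solution_iff[OF J] unfolding shifted_periodic_bvp_def Let_def by auto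
    obtain e1 e2 where e: "\<And>t. t \<in> I \<Longrightarrow> u t = e1 * x1 t + e2 * x2 t" "\<And>t. t \<in> I \<Longrightarrow> y t = e1 * y1 t + e2 * y2 t"
      using system_representation[OF J y] by blast
    have "bd1 u = e1 * bd1 x1 + e2 * bd1 x2" "bd2 y = e1 * bd2 y1 + e2 * bd2 y2"
      unfolding bd_linear[symmetric] using e ab_mem by (simp_all add: bd1_def bd2_def)
    then have "e1 = d1 s" "e2 = d2 s"
      using u bc[OF y] d_iff[of e1 e2 s] by auto
    then show "\<forall>t\<in>I. u t = d1 s * x1 t + d2 s * x2 t" using e by simp
  next
    assume u: "\<forall>t\<in>I. u t = d1 s * x1 t + d2 s * x2 t"
    then have sys: "system I (\<lambda>_. 0) u (\<lambda>t. d1 s * y1 t + d2 s * y2 t)"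
      by (intro first_order_system_cong[OF system_combination]) auto
    have "bd1 u = bd1 (\<lambda>t. d1 s * x1 t + d2 s * x2 t)"
      using u ab_mem by (simp add: bd1_def)
    then show "shifted_periodic_bvp \<kappa>0 \<kappa>1 \<alpha> p q I a b (\<lambda>t. X t s) u"
      using bc[OF sys] d_iff[of "d1 s" "d2 s" s] by (simp add: bd_linear)
  qed
qed

section \<open>The Green integral as variation of parameters\<close>

lemma integral_representation:
  assumes g: "continuous_on {a..b} g" and t: "t \<in> {a..b}"
    and G: "\<And>s. s \<in> {a..b} \<Longrightarrow> G s = d1 s * x1 t + d2 s * x2 t
        + (if s \<le> t then c1 s * x1 t + c2 s * x2 t else 0)"
  shows "(LBINT s=ereal a..ereal b. G s * g s) =
    ((LBINT s=ereal a..ereal b. d1 s * g s) + (LBINT s=ereal a..ereal t. c1 s * g s)) * x1 t +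
    ((LBINT s=ereal a..ereal b. d2 s * g s) + (LBINT s=ereal a..ereal t. c2 s * g s)) * x2 t"
proof -
  note cont = continuous_on_subset[OF continuous_d(1) ab(2)] continuous_on_subset[OF continuous_d(2) ab(2)]
    continuous_on_subset[OF continuous_c(1) ab(2)] continuous_on_subset[OF continuous_c(2) ab(2)]
  let ?f = "\<lambda>s. x1 t * (d1 s * g s) + x2 t * (d2 s * g s)"
  let ?k = "\<lambda>s. x1 t * (c1 s * g s) + x2 t * (c2 s * g s)"
  let ?m = "\<lambda>s. if s \<le> t then ?k s else 0"
  have contg: "continuous_on {a..b} (\<lambda>s. c s * g s)" if "continuous_on {a..b} c" for c
    using that g by (rule continuous_on_mult)
  have contk: "continuous_on {a..b} ?k"
    by (intro continuous_on_add continuous_on_mult continuous_on_const contg cont g)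
  \<comment> \<open>The truncated integrand has no jump at \<open>s = t\<close>: there
    \<open>?k t\<close> is \<open>g t\<close> times the Cauchy function on the diagonal, which is
    zero.\<close>
  have "?k t = (x1 t * c1 t + x2 t * c2 t) * g t" by (simp add: algebra_simps)
  then have "?k t = 0" using c_diag t ab by auto
  then have contm: "continuous_on {a..b} ?m"
    by (intro continuous_on_cases_le continuous_on_subset[OF contk] continuous_on_const
        continuous_on_id) auto
  have "(LBINT s=ereal a..ereal b. G s * g s) = (LBINT s=ereal a..ereal b. 1 * ?f s + 1 * ?m s)"
    using ab G by (intro interval_integral_cong) (auto simp: einterval_iff algebra_simps)
  also have "\<dots> = (LBINT s=ereal a..ereal b. ?f s) + (LBINT s=ereal a..ereal b. ?m s)"
    using ab by (subst interval_integral_lincomb)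
      (auto intro!: contm continuous_on_add continuous_on_mult continuous_on_const contg cont g)
  also have "(LBINT s=ereal a..ereal b. ?m s) =
      (LBINT s=ereal a..ereal t. ?m s) + (LBINT s=ereal t..ereal b. ?m s)"
    using t ab interval_integrable_continuous_on[OF _ contm]
    by (intro interval_integral_sum[symmetric]) (auto simp: min_def max_def)
  \<comment> \<open>Only the open interval counts, and there \<open>t < s\<close>.\<close>
  also have "(LBINT s=ereal t..ereal b. ?m s) = (LBINT s=ereal t..ereal b. 0)"
    using t by (intro interval_integral_cong) (auto simp: einterval_iff)
  also have "(LBINT s=ereal a..ereal t. ?m s) = (LBINT s=ereal a..ereal t. ?k s)"
    using t by (intro interval_integral_cong) (auto simp: einterval_iff)
  also have "\<dots> = x1 t * (LBINT s=ereal a..ereal t. c1 s * g s) + x2 t * (LBINT s=ereal a..ereal t. c2 s * g s)"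
    using t by (intro interval_integral_lincomb continuous_on_subset[OF contg[OF cont(3)]]
        continuous_on_subset[OF contg[OF cont(4)]]) auto
  also have "(LBINT s=ereal a..ereal b. ?f s) =
      x1 t * (LBINT s=ereal a..ereal b. d1 s * g s) + x2 t * (LBINT s=ereal a..ereal b. d2 s * g s)"
    using ab by (intro interval_integral_lincomb contg cont) auto
  finally show ?thesis by (simp add: algebra_simps)
qed

text \<open>The coefficients of \<open>x1\<close> and \<open>x2\<close> have derivatives
  \<open>c1 * h / \<kappa>0\<close> and \<open>c2 * h / \<kappa>0\<close>, so \<open>c_diag\<close>
  gives the conditions of variation of parameters. The boundary conditions come from integrating the
  linear system for \<open>d1\<close>, \<open>d2\<close> against
  \<open>h / \<kappa>0\<close>.\<close>

lemma periodic_bvp_variation_of_parameters: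
  assumes h: "continuous_on {a..b} h"
    and x: "\<And>t. t \<in> {a..b} \<Longrightarrow> x t =
      ((LBINT s=ereal a..ereal b. d1 s * (h s / \<kappa>0 \<alpha> s)) + (LBINT s=ereal a..ereal t. c1 s * (h s / \<kappa>0 \<alpha> s))) * x1 t +
      ((LBINT s=ereal a..ereal b. d2 s * (h s / \<kappa>0 \<alpha> s)) + (LBINT s=ereal a..ereal t. c2 s * (h s / \<kappa>0 \<alpha> s))) * x2 t"
  shows "periodic_bvp \<kappa>0 \<kappa>1 \<alpha> p q a b h x"
proof -
  let ?g = "\<lambda>s. h s / \<kappa>0 \<alpha> s"
  note cont = continuous_on_subset[OF continuous_d(1) ab(2)] continuous_on_subset[OF continuous_d(2) ab(2)]
    continuous_on_subset[OF continuous_c(1) ab(2)] continuous_on_subset[OF continuous_c(2) ab(2)]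
  have g: "continuous_on {a..b} ?g"
    using h continuous_on_subset[OF cont_k0 ab(2)] k0_nz ab(2) by (intro continuous_on_divide) auto
  have contg: "continuous_on {a..b} (\<lambda>s. c s * ?g s)" if "continuous_on {a..b} c" for c
    using that g by (rule continuous_on_mult)
  define C1 where "C1 = (LBINT s=ereal a..ereal b. d1 s * ?g s)"
  define C2 where "C2 = (LBINT s=ereal a..ereal b. d2 s * ?g s)"
  define K1 where "K1 = (\<lambda>t. LBINT s=ereal a..ereal t. c1 s * ?g s)"
  define K2 where "K2 = (\<lambda>t. LBINT s=ereal a..ereal t. c2 s * ?g s)"
  define y where "y = (\<lambda>t. (C1 + K1 t) * y1 t + (C2 + K2 t) * y2 t)"
  have FTC: "((\<lambda>t. C + (LBINT s=ereal a..ereal t. c s * ?g s)) has_real_derivative c t * ?g t) (at t within {a..b})"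
    if c: "continuous_on {a..b} c" and t: "t \<in> {a..b}" for C c t
  proof -
    have "((\<lambda>t. LBINT s=ereal a..ereal t. c s * ?g s) has_real_derivative c t * ?g t) (at t within {a..b})"
      unfolding has_real_derivative_iff_has_vector_derivative
      using t by (intro interval_integral_FTC2 contg c) auto
    then show ?thesis by (auto intro!: derivative_eq_intros)
  qed
  have diag: "x1 t * (c1 t * ?g t) + x2 t * (c2 t * ?g t) = 0"
    "\<kappa>0 \<alpha> t * (y1 t * (c1 t * ?g t) + y2 t * (c2 t * ?g t)) = h t" if "t \<in> {a..b}" for t
  proof -
    have tI: "t \<in> I" using that ab by auto
    have "x1 t * (c1 t * ?g t) + x2 t * (c2 t * ?g t) = (x1 t * c1 t + x2 t * c2 t) * ?g t"
      "y1 t * (c1 t * ?g t) + y2 t * (c2 t * ?g t) = (y1 t * c1 t + y2 t * c2 t) * ?g t"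
      by (simp_all add: algebra_simps)
    then show "x1 t * (c1 t * ?g t) + x2 t * (c2 t * ?g t) = 0"
      "\<kappa>0 \<alpha> t * (y1 t * (c1 t * ?g t) + y2 t * (c2 t * ?g t)) = h t"
      unfolding c_diag[OF tI] using k0_nz[OF tI] by simp_all
  qed
  have "system {a..b} h (\<lambda>t. (C1 + K1 t) * x1 t + (C2 + K2 t) * x2 t) y"
    unfolding y_def K1_def K2_def
    by (rule first_order_system_variation[OF _ first_order_system_subset[OF sys1 ab(2)]
        first_order_system_subset[OF sys2 ab(2)] FTC[OF cont(3)] FTC[OF cont(4)]])
       (use k0_nz ab(2) diag in auto)
  then have sys: "system {a..b} h x y"
    by (rule first_order_system_cong) (simp add: x C1_def C2_def K1_def K2_def)
  have d: "d1 s * bd1 x1 + d2 s * bd1 x2 = R1 s" "d1 s * bd2 y1 + d2 s * bd2 y2 = R2 s" for s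
    using d_iff[of "d1 s" "d2 s" s] by auto
  have K_a: "K1 a = 0" "K2 a = 0"
    by (simp_all add: K1_def K2_def)
  have bd: "bd1 x1 * C1 + bd1 x2 * C2 = (E * x1 b) * K1 b + (E * x2 b) * K2 b"
    "bd2 y1 * C1 + bd2 y2 * C2 = (E * (y1 b / p b)) * K1 b + (E * (y2 b / p b)) * K2 b"
  proof -
    \<comment> \<open>A linear relation between the \<open>d\<close> and \<open>c\<close>
      coefficients, valid for every \<open>s\<close>, passes to their integrals against
      \<open>?g\<close> over \<open>{a..b}\<close>.\<close>
    have lin: "r * C1 + r' * C2 = m * K1 b + m' * K2 b"
      if "\<And>s. d1 s * r + d2 s * r' = m * c1 s + m' * c2 s" for r r' m m'
    proof -
      have "r * (d1 s * ?g s) + r' * (d2 s * ?g s) = m * (c1 s * ?g s) + m' * (c2 s * ?g s)" for s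
        using arg_cong[OF that[of s], of "\<lambda>z. z * ?g s"] by (simp only: algebra_simps)
      then show ?thesis
        unfolding C1_def C2_def K1_def K2_def
        using interval_integral_lincomb[OF less_imp_le[OF ab(1)] contg contg, OF cont(1,2), of r r']
          interval_integral_lincomb[OF less_imp_le[OF ab(1)] contg contg, OF cont(3,4), of m m']
        by (simp only:)
    qed
    show "bd1 x1 * C1 + bd1 x2 * C2 = (E * x1 b) * K1 b + (E * x2 b) * K2 b"
      by (rule lin, unfold d) (simp add: R1_def algebra_simps)
    show "bd2 y1 * C1 + bd2 y2 * C2 = (E * (y1 b / p b)) * K1 b + (E * (y2 b / p b)) * K2 b"
      by (rule lin, unfold d) (simp add: R2_def add_divide_distrib algebra_simps)
  qed
  \<comment> \<open>\<open>K1\<close> and \<open>K2\<close> vanish at \<open>a\<close>, so they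
    enter the boundary functionals only through \<open>b\<close>, with factor \<open>- E\<close>. By
    \<open>bd\<close> this cancels the contribution of \<open>C1\<close> and
    \<open>C2\<close>.\<close>
  have "x a = C1 * x1 a + C2 * x2 a" "x b = (C1 + K1 b) * x1 b + (C2 + K2 b) * x2 b"
    using x ab K_a by (simp_all add: C1_def C2_def K1_def K2_def)
  then have "bd1 x = bd1 x1 * C1 + bd1 x2 * C2 - ((E * x1 b) * K1 b + (E * x2 b) * K2 b)"
    by (simp add: bd1_def algebra_simps)
  moreover have "bd2 y = bd2 y1 * C1 + bd2 y2 * C2 - ((E * (y1 b / p b)) * K1 b + (E * (y2 b / p b)) * K2 b)"
    using K_a by (simp add: bd2_def y_def add_divide_distrib algebra_simps)
  ultimately show ?thesis
    using sys bd periodic_bvp_iff[OF h] by auto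
qed

lemma periodic_bvp_unique:
  assumes h: "continuous_on {a..b} h"
    and x: "periodic_bvp \<kappa>0 \<kappa>1 \<alpha> p q a b h x" and z: "periodic_bvp \<kappa>0 \<kappa>1 \<alpha> p q a b h z"
    and t: "t \<in> {a..b}"
  shows "x t = z t"
proof -
  obtain y w where y: "system {a..b} h x y" "bd1 x = 0" "bd2 y = 0"
    and w: "system {a..b} h z w" "bd1 z = 0" "bd2 w = 0"
    using x z periodic_bvp_iff[OF h] by auto
  have "system {a..b} (\<lambda>_. 0) (\<lambda>t. 1 * x t + (- 1) * z t) (\<lambda>t. 1 * y t + (- 1) * w t)"
    using first_order_system_linear[OF _ y(1) w(1), of 1 "- 1"] k0_nz ab by force
  moreover have "bd1 (\<lambda>t. 1 * x t + (- 1) * z t) = 0" "bd2 (\<lambda>t. 1 * y t + (- 1) * w t) = 0"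
    unfolding bd_linear using y w by simp_all
  ultimately have "periodic_bvp \<kappa>0 \<kappa>1 \<alpha> p q a b (\<lambda>_. 0) (\<lambda>t. 1 * x t + (- 1) * z t)"
    unfolding periodic_bvp_iff[OF continuous_on_const] by blast
  then show ?thesis using trivial t by force
qed

end

section \<open>The Green's function theorem\<close>

theorem theorem11p17:
  fixes I :: "real set" and \<kappa>0 \<kappa>1 :: "real \<Rightarrow> real \<Rightarrow> real" and \<alpha> a b :: real
    and p q :: "real \<Rightarrow> real" and X :: "real \<Rightarrow> real \<Rightarrow> real"
  assumes "is_interval I" and "\<exists>c\<in>I. \<exists>d\<in>I. c \<noteq> d"
    and "conformable_kernels I \<kappa>0 \<kappa>1"
    and "0 < \<alpha>" and "\<alpha> \<le> 1"
    and "continuous_on I p" and "continuous_on I q" and "\<forall>t\<in>I. p t > 0"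
    and "a < b" and "{a..b} \<subseteq> I"
    and "cauchy_function \<kappa>0 \<kappa>1 \<alpha> p q I X"
    and "\<forall>x. periodic_bvp \<kappa>0 \<kappa>1 \<alpha> p q a b (\<lambda>_. 0) x \<longrightarrow> (\<forall>t\<in>{a..b}. x t = 0)"
  shows
    "(\<forall>s\<in>I. \<exists>u. shifted_periodic_bvp \<kappa>0 \<kappa>1 \<alpha> p q I a b (\<lambda>t. X t s) u \<and>
        (\<forall>w. shifted_periodic_bvp \<kappa>0 \<kappa>1 \<alpha> p q I a b (\<lambda>t. X t s) w \<longrightarrow> (\<forall>t\<in>I. w t = u t))) \<and>
     (\<forall>u v G.
        (\<forall>s\<in>I. shifted_periodic_bvp \<kappa>0 \<kappa>1 \<alpha> p q I a b (\<lambda>t. X t s) (\<lambda>t. u t s)) \<and>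
        v = (\<lambda>t s. u t s + X t s) \<and>
        G = green_function u v \<longrightarrow>
        (\<forall>h. continuous_on {a..b} h \<longrightarrow>
           (let x = (\<lambda>t. LBINT s=ereal a..ereal b. G t s * h s / \<kappa>0 \<alpha> s) in
              periodic_bvp \<kappa>0 \<kappa>1 \<alpha> p q a b h x \<and>
              (\<forall>y. periodic_bvp \<kappa>0 \<kappa>1 \<alpha> p q a b h y \<longrightarrow> (\<forall>t\<in>{a..b}. y t = x t)))) \<and>
        (\<forall>s\<in>{a..b}.
           conf_solution \<kappa>0 \<kappa>1 \<alpha> p q I (\<lambda>_. 0) (\<lambda>t. v t s) \<and>
           u a s = conf_exp0 \<kappa>0 \<kappa>1 \<alpha> a b * v b s \<and>
           conf_deriv \<kappa>0 \<kappa>1 \<alpha> I (\<lambda>t. u t s) a =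
             conf_exp0 \<kappa>0 \<kappa>1 \<alpha> a b * conf_deriv \<kappa>0 \<kappa>1 \<alpha> I (\<lambda>t. v t s) b))"
proof -
  have \<alpha>: "\<alpha> \<in> {0..1}" "\<alpha> \<in> {0<..1}" using assms(4,5) by auto
  have "Pair \<alpha> ` I \<subseteq> {0..1} \<times> I" using \<alpha> by auto
  then have "continuous_on I (\<kappa>0 \<alpha>)" "continuous_on I (\<kappa>1 \<alpha>)"
    using assms(3) continuous_on_compose2[of "{0..1} \<times> I" "\<lambda>(\<alpha>, t). \<kappa>0 \<alpha> t" I "Pair \<alpha>"]
      continuous_on_compose2[of "{0..1} \<times> I" "\<lambda>(\<alpha>, t). \<kappa>1 \<alpha> t" I "Pair \<alpha>"]
    by (auto simp: conformable_kernels_def continuous_on_Pair)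
  moreover have "\<kappa>0 \<alpha> t > 0" if "t \<in> I" for t
    using assms(3) \<alpha> that unfolding conformable_kernels_def by (metis less_eq_real_def)
  ultimately interpret conformable_equation I \<kappa>0 \<kappa>1 \<alpha> p q
    using assms(1,2,6-8) by unfold_locales auto
  note X = assms(11)
  obtain x1 y1 x2 y2 where "system I (\<lambda>_. 0) x1 y1" "system I (\<lambda>_. 0) x2 y2"
    "\<And>t. t \<in> I \<Longrightarrow> x1 t * y2 t - x2 t * y1 t \<noteq> 0"
    using cauchy_fundamental_system[OF X] by blast
  then interpret periodic_problem I \<kappa>0 \<kappa>1 \<alpha> p q x1 y1 x2 y2 a b "conf_exp0 \<kappa>0 \<kappa>1 \<alpha> a b"
    using assms(9,10,12) by unfold_locales auto
  note shifted = shifted_iff[OF X]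
  show ?thesis
  proof (intro conjI ballI allI impI; (elim conjE)?)
    fix s assume s: "s \<in> I"
    show "\<exists>u. shifted_periodic_bvp \<kappa>0 \<kappa>1 \<alpha> p q I a b (\<lambda>t. X t s) u \<and>
        (\<forall>w. shifted_periodic_bvp \<kappa>0 \<kappa>1 \<alpha> p q I a b (\<lambda>t. X t s) w \<longrightarrow> (\<forall>t\<in>I. w t = u t))"
      \<comment> \<open>After unfolding, the boundary value problem says that the function equals an
        explicit combination on \<open>I\<close>.\<close>
      unfolding shifted[OF s] by (rule exI[of _ "\<lambda>t. d1 s * x1 t + d2 s * x2 t"]) simp
  next
    fix u v G and h :: "real \<Rightarrow> real"
    assume u: "\<forall>s\<in>I. shifted_periodic_bvp \<kappa>0 \<kappa>1 \<alpha> p q I a b (\<lambda>t. X t s) (\<lambda>t. u t s)"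
      and v: "v = (\<lambda>t s. u t s + X t s)" and G: "G = green_function u v"
      and h: "continuous_on {a..b} h"
    have "G t s = d1 s * x1 t + d2 s * x2 t + (if s \<le> t then c1 s * x1 t + c2 s * x2 t else 0)"
      if t: "t \<in> {a..b}" and s: "s \<in> {a..b}" for t s
    proof -
      have I: "t \<in> I" "s \<in> I" using t s ab by auto
      then have "u t s = d1 s * x1 t + d2 s * x2 t" using u shifted[OF I(2), of "\<lambda>t. u t s"] I by auto
      \<comment> \<open>On the diagonal \<open>green_function\<close> takes \<open>u\<close>, while
        the representation adds the Cauchy term; \<open>X s s = 0\<close> reconciles the
        two.\<close>
      moreover have "X s s = 0" using X I by (simp add: cauchy_function_def)
      ultimately show ?thesis
        using cauchy_representation(1)[OF X I(2) I(1)] by (auto simp: G v green_function_def)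
    qed
    moreover have "continuous_on {a..b} (\<lambda>s. h s / \<kappa>0 \<alpha> s)"
      using h continuous_on_subset[OF cont_k0 ab(2)] k0_nz ab(2) by (intro continuous_on_divide) auto
    ultimately have "periodic_bvp \<kappa>0 \<kappa>1 \<alpha> p q a b h (\<lambda>t. LBINT s=ereal a..ereal b. G t s * (h s / \<kappa>0 \<alpha> s))"
      by (intro periodic_bvp_variation_of_parameters[OF h] integral_representation)
    then have bvp: "periodic_bvp \<kappa>0 \<kappa>1 \<alpha> p q a b h (\<lambda>t. LBINT s=ereal a..ereal b. G t s * h s / \<kappa>0 \<alpha> s)"
      by simp
    then show "let x = (\<lambda>t. LBINT s=ereal a..ereal b. G t s * h s / \<kappa>0 \<alpha> s) in
        periodic_bvp \<kappa>0 \<kappa>1 \<alpha> p q a b h x \<and>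
        (\<forall>y. periodic_bvp \<kappa>0 \<kappa>1 \<alpha> p q a b h y \<longrightarrow> (\<forall>t\<in>{a..b}. y t = x t))"
      unfolding Let_def using periodic_bvp_unique[OF h _ bvp] by blast
  next
    fix u v G s
    assume u: "\<forall>s\<in>I. shifted_periodic_bvp \<kappa>0 \<kappa>1 \<alpha> p q I a b (\<lambda>t. X t s) (\<lambda>t. u t s)"
      and v: "v = (\<lambda>t s. u t s + X t s)" and s: "s \<in> {a..b}"
    have sI: "s \<in> I" using s ab by auto
    note J = subinterval_self
    have us: "shifted_periodic_bvp \<kappa>0 \<kappa>1 \<alpha> p q I a b (\<lambda>t. X t s) (\<lambda>t. u t s)"
      using u sI by blast
    then obtain y where y: "system I (\<lambda>_. 0) (\<lambda>t. u t s) y"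
      using solution_iff[OF J] unfolding shifted_periodic_bvp_def Let_def by auto
    obtain z where z: "system I (\<lambda>_. 0) (\<lambda>t. X t s) z"
      using X sI solution_iff[OF J] unfolding cauchy_function_def by auto
    have vs: "system I (\<lambda>_. 0) (\<lambda>t. v t s) (\<lambda>t. y t + z t)"
      using first_order_system_linear[OF k0_nz y z, of 1 1] by (simp add: v)
    then show "conf_solution \<kappa>0 \<kappa>1 \<alpha> p q I (\<lambda>_. 0) (\<lambda>t. v t s)"
      using solution_iff[OF J] by auto
    show "u a s = conf_exp0 \<kappa>0 \<kappa>1 \<alpha> a b * v b s"
      using us by (simp add: shifted_periodic_bvp_def Let_def v)
    \<comment> \<open>Additivity is read off from the second components divided by
      \<open>p b\<close>.\<close>
    have "D I (\<lambda>t. v t s) b = D I (\<lambda>t. u t s) b + D I (\<lambda>t. X t s) b"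
      using system_D[OF J vs ab_mem(2)] system_D[OF J y ab_mem(2)] system_D[OF J z ab_mem(2)]
      by (simp add: add_divide_distrib)
    then show "D I (\<lambda>t. u t s) a = conf_exp0 \<kappa>0 \<kappa>1 \<alpha> a b * D I (\<lambda>t. v t s) b"
      using us by (simp add: shifted_periodic_bvp_def Let_def)
  qed
qed

end
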